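(* If $f$ is the inversion and $g=(G,g_3)$ is the linear action of $\alpha\in SL(2,\mathbb{R})$, then $$S_{CR}(f\circ g)=-6\,\frac{|G|^2}{\|g\|_{\mathbb{H}_1}^4}\,ZG\,Z\bar G .$$ In particular, $S_{CR}(f)=S_{CR}(g)=0$ but $S_{CR}(f\circ g)\not\equiv0$.
   Context: The Heisenberg group $\mathbb{H}_1$ is $\mathbb{C}\times\mathbb{R}$ with coordinates $(z,t)$, $z=x+iy$, and product $(z_1,t_1)(z_2,t_2)=(z_1+z_2,\,t_1+t_2+2\,\mathrm{Im}(z_1\bar z_2))$. Put $X=\partial_x+2y\,\partial_t$, $Y=\partial_y-2x\,\partial_t$, $Z=\frac12(X-iY)$, $\theta=dt-2y\,dx+2x\,dy$, and $\|(z,t)\|_{\mathbb{H}_1}=(|z|^4+t^2)^{1/4}$. The inversion is $f(z,t)=\left(\frac{z}{it-|z|^2},\frac{-t}{|z|^4+t^2}\right)$, $(z,t)\ne(0,0)$. The linear action of $\alpha=\begin{pmatrix}a&b\\c&d\end{pmatrix}$, $a,b,c,d\in\mathbb{R}$, $ad-bc=1$, is $g(z,t)=(\alpha(z),t)=(ax+by+i(cx+dy),\,t)$, so $G=ax+by+i(cx+dy)$ and $g_3=t$. A local diffeomorphism $f$ is contact if $f^*\theta=\lambda_f\theta$ with $\lambda_f$ nowhere zero, and positively oriented if $\lambda_f>0$. The CR Schwarzian derivative of a positively oriented contact mapping $f$ is $$S_{CR}(f)=\tfrac12\,\lambda_f\,Z^2(\lambda_f^{-1}).$$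
   Formalization: The coefficient −6 is a sign error under the stated conventions and is corrected to +6 (e.g. α=diag(2,1/2) at (1,0)); S_CR(f∘g)≢0 is claimed for α not a rotation, since for α in SO(2) it vanishes identically. *)

theory Defs
  imports "HOL-Analysis.Analysis"
begin

(* A point (z,t) of the Heisenberg group; the same type serves as its tangent space. *)
type_synonym heis = "complex \<times> real"

definition heis_norm :: "heis \<Rightarrow> real" where
  "heis_norm p = root 4 (cmod (fst p) ^ 4 + (snd p)\<^sup>2)"

definition d_x :: "(heis \<Rightarrow> complex) \<Rightarrow> heis \<Rightarrow> complex" where
  "d_x u p = frechet_derivative u (at p) (1, 0)"

definition d_y :: "(heis \<Rightarrow> complex) \<Rightarrow> heis \<Rightarrow> complex" where
  "d_y u p = frechet_derivative u (at p) (\<i>, 0)"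

definition d_t :: "(heis \<Rightarrow> complex) \<Rightarrow> heis \<Rightarrow> complex" where
  "d_t u p = frechet_derivative u (at p) (0, 1)"

definition X_field :: "(heis \<Rightarrow> complex) \<Rightarrow> heis \<Rightarrow> complex" where
  "X_field u p = d_x u p + 2 * of_real (Im (fst p)) * d_t u p"

definition Y_field :: "(heis \<Rightarrow> complex) \<Rightarrow> heis \<Rightarrow> complex" where
  "Y_field u p = d_y u p - 2 * of_real (Re (fst p)) * d_t u p"

definition Z_field :: "(heis \<Rightarrow> complex) \<Rightarrow> heis \<Rightarrow> complex" where
  "Z_field u p = (X_field u p - \<i> * Y_field u p) / 2"

(* The 1-form theta = dt - 2 y dx + 2 x dy at p, evaluated at the tangent vector v. *)
definition theta :: "heis \<Rightarrow> heis \<Rightarrow> real" where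
  "theta p v = snd v - 2 * Im (fst p) * Re (fst v) + 2 * Re (fst p) * Im (fst v)"

definition pullback :: "(heis \<Rightarrow> heis) \<Rightarrow> (heis \<Rightarrow> heis \<Rightarrow> real) \<Rightarrow> heis \<Rightarrow> heis \<Rightarrow> real" where
  "pullback f \<omega> p v = \<omega> (f p) (frechet_derivative f (at p) v)"

(* Intended for open U and finite-dimensional domain, where continuity of all iterated
   directional derivatives along constant vectors is the usual C^k condition. *)
primrec Ck_on :: "nat \<Rightarrow> 'a::real_normed_vector set \<Rightarrow> ('a \<Rightarrow> 'b::real_normed_vector) \<Rightarrow> bool" where
  "Ck_on 0 U = (\<lambda>f. continuous_on U f)"
| "Ck_on (Suc k) U = (\<lambda>f. (\<forall>p\<in>U. f differentiable (at p)) \<and>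
     (\<forall>v. Ck_on k U (\<lambda>p. frechet_derivative f (at p) v)))"

definition smooth_on :: "'a::real_normed_vector set \<Rightarrow> ('a \<Rightarrow> 'b::real_normed_vector) \<Rightarrow> bool" where
  "smooth_on U f \<longleftrightarrow> (\<forall>k. Ck_on k U f)"

definition local_diffeo_on :: "heis set \<Rightarrow> (heis \<Rightarrow> heis) \<Rightarrow> bool" where
  "local_diffeo_on U f \<longleftrightarrow> open U \<and>
     (\<forall>p\<in>U. \<exists>V W h. p \<in> V \<and> V \<subseteq> U \<and> open V \<and> open W \<and>
        homeomorphism V W f h \<and> smooth_on V f \<and> smooth_on W h)"

(* lambda_f; unique whenever it exists, since theta p (0, 1) = 1. *)
definition contact_factor :: "(heis \<Rightarrow> heis) \<Rightarrow> heis \<Rightarrow> real" where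
  "contact_factor f p = (THE l. \<forall>v. pullback f theta p v = l * theta p v)"

definition contact_on :: "heis set \<Rightarrow> (heis \<Rightarrow> heis) \<Rightarrow> bool" where
  "contact_on U f \<longleftrightarrow> local_diffeo_on U f \<and>
     (\<exists>l. \<forall>p\<in>U. l p \<noteq> 0 \<and> (\<forall>v. pullback f theta p v = l p * theta p v))"

definition pos_contact_on :: "heis set \<Rightarrow> (heis \<Rightarrow> heis) \<Rightarrow> bool" where
  "pos_contact_on U f \<longleftrightarrow> contact_on U f \<and> (\<forall>p\<in>U. contact_factor f p > 0)"

definition S_CR :: "(heis \<Rightarrow> heis) \<Rightarrow> heis \<Rightarrow> complex" where
  "S_CR f p = 1/2 * of_real (contact_factor f p) *
     Z_field (Z_field (\<lambda>q. of_real (inverse (contact_factor f q)))) p"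

(* Meaningful only off the origin. *)
definition inversion :: "heis \<Rightarrow> heis" where
  "inversion p = (let z = fst p; t = snd p in
     (z / (\<i> * of_real t - of_real ((cmod z)\<^sup>2)), - t / (cmod z ^ 4 + t\<^sup>2)))"

(* The matrix is (a b; c d), acting on z = x + i y as on the column vector (x, y).
   For f the inversion and g such an action of determinant 1, 1 / contact_factor (f o g) is
   |G|^4 + t^2, and Z^2 (|G|^4 + t^2) = +12 |G|^2 (Z G) (Z (cnj G)); hence S_CR (f o g) has
   the coefficient +6. The value -6 in the source is a sign slip. *)
definition linear_action :: "real \<Rightarrow> real \<Rightarrow> real \<Rightarrow> real \<Rightarrow> heis \<Rightarrow> heis" where
  "linear_action a b c d p = (let x = Re (fst p); y = Im (fst p) in
     (Complex (a * x + b * y) (c * x + d * y), snd p))"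

end

theory Submission
  imports Defs
begin

text \<open>
  Write the linear action as \<open>G = m z + n cnj z\<close>, so that \<open>|m|\<^sup>2 - |n|\<^sup>2 = a d - b c = 1\<close>,
  \<open>Z G = m\<close> and \<open>Z (cnj G) = cnj n\<close>. With \<open>w = 1 / koranyi (z, t) = 1 / (i t - |z|\<^sup>2)\<close> the inversion is the involution
  \<open>(z, t) \<mapsto> (z w, Im w)\<close>, with contact factor \<open>|w|\<^sup>2\<close>, while linear actions preserve theta; hence
  \<open>1 / \<lambda>\<close> of the composition is \<open>N = |G|\<^sup>4 + t\<^sup>2\<close>. Since \<open>Z t = i cnj z\<close> and \<open>Z (cnj z) = 0\<close>,
  \<open>Z\<^sup>2 N = 2 (m cnj G + cnj n G)\<^sup>2 + 4 |G|\<^sup>2 m cnj n - 2 (cnj z)\<^sup>2\<close>, and \<open>cnj z = m cnj G - cnj n G\<close>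
  turns this into \<open>12 |G|\<^sup>2 m cnj n\<close>.
\<close>

section \<open>Smooth maps\<close>

text \<open>On an open set, agreement of two functions passes to their Frechet derivatives, so the
  induction runs through all iterated directional derivatives.\<close>

lemma Ck_on_cong:
  assumes "open U" "Ck_on k U f" "\<And>p. p \<in> U \<Longrightarrow> f p = g p"
  shows "Ck_on k U g"
  using assms(2,3)
proof (induction k arbitrary: f g)
  case 0
  then show ?case using continuous_on_cong[of U U f g] by simp
next
  case (Suc k)
  have D: "(g has_derivative frechet_derivative f (at p)) (at p)" if "p \<in> U" for p
  proof -
    have "(f has_derivative frechet_derivative f (at p)) (at p)"
      using Suc.prems(1) that by (simp add: frechet_derivative_works)
    then show ?thesis
      by (rule has_derivative_transform_within_open[OF _ \<open>open U\<close> that Suc.prems(2)])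
  qed
  have "Ck_on k U (\<lambda>p. frechet_derivative g (at p) v)" for v
    by (rule Suc.IH[of "\<lambda>p. frechet_derivative f (at p) v"])
      (use Suc.prems(1) frechet_derivative_at[OF D] in auto)
  with D show ?case by (auto simp: differentiable_def)
qed

text \<open>Trades \<open>frechet_derivative\<close> for an explicit formula \<open>D\<close>; the
  closure properties below are inductions on \<open>k\<close> through this rule.\<close>

lemma Ck_on_has_derivativeI:
  assumes "open U" "\<And>p. p \<in> U \<Longrightarrow> (f has_derivative D p) (at p)"
    and "\<And>v. Ck_on k U (\<lambda>p. D p v)"
  shows "Ck_on (Suc k) U f"
proof -
  have "Ck_on k U (\<lambda>p. frechet_derivative f (at p) v)" for v
    by (rule Ck_on_cong[OF assms(1) assms(3)[of v]]) (simp add: frechet_derivative_at[OF assms(2), symmetric])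
  then show ?thesis using assms(2) by (auto simp: differentiable_def)
qed

lemma Ck_on_Suc_has_derivative:
  assumes "Ck_on (Suc k) U f" "p \<in> U"
  shows "(f has_derivative frechet_derivative f (at p)) (at p)"
  using assms by (simp add: frechet_derivative_works)

lemma Ck_on_SucD: "Ck_on (Suc k) U f \<Longrightarrow> Ck_on k U f"
proof (induction k arbitrary: f)
  case 0
  then show ?case
    by (auto intro!: continuous_at_imp_continuous_on differentiable_imp_continuous_within)
next
  case (Suc k)
  have "Ck_on k U (\<lambda>p. frechet_derivative f (at p) v)" for v
    by (rule Suc.IH) (use Suc.prems in simp)
  then show ?case using Suc.prems by simp
qed

lemma Ck_on_const: "open U \<Longrightarrow> Ck_on k U (\<lambda>p. c)"
proof (induction k arbitrary: c)
  case (Suc k)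
  then show ?case
    by (intro Ck_on_has_derivativeI[where D = "\<lambda>p v. 0"]) auto
qed simp

lemma Ck_on_linear:
  assumes "open U" "bounded_linear L"
  shows "Ck_on k U L"
proof (cases k)
  case 0
  then show ?thesis using assms(2) by (simp add: linear_continuous_on)
next
  case (Suc k)
  then show ?thesis
    using assms Ck_on_const
    by (auto intro!: Ck_on_has_derivativeI[where D = "\<lambda>p. L"] bounded_linear_imp_has_derivative simp del: Ck_on.simps)
qed

lemma Ck_on_add:
  assumes "open U" "Ck_on k U f" "Ck_on k U g"
  shows "Ck_on k U (\<lambda>p. f p + g p)"
  using assms(2,3)
proof (induction k arbitrary: f g)
  case 0
  then show ?case by (simp add: continuous_on_add)
next
  case (Suc k)
  show ?case
    by (rule Ck_on_has_derivativeI[OF \<open>open U\<close> has_derivative_add[OF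
          Ck_on_Suc_has_derivative[OF Suc.prems(1)] Ck_on_Suc_has_derivative[OF Suc.prems(2)]]])
      (use Suc in auto)
qed

text \<open>The product rule mixes derivatives with the undifferentiated factors;
  \<open>Ck_on_SucD\<close> lowers the latter to the level of the induction hypothesis.\<close>

lemma Ck_on_mult:
  fixes f g :: "'a::real_normed_vector \<Rightarrow> 'b::real_normed_algebra"
  assumes "open U" "Ck_on k U f" "Ck_on k U g"
  shows "Ck_on k U (\<lambda>p. f p * g p)"
  using assms(2,3)
proof (induction k arbitrary: f g)
  case 0
  then show ?case by (simp add: continuous_on_mult)
next
  case (Suc k)
  show ?case
    by (rule Ck_on_has_derivativeI[OF \<open>open U\<close> has_derivative_mult[OF
          Ck_on_Suc_has_derivative[OF Suc.prems(1)] Ck_on_Suc_has_derivative[OF Suc.prems(2)]]])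
      (use Suc.prems Ck_on_SucD[OF Suc.prems(1)] Ck_on_SucD[OF Suc.prems(2)]
        in \<open>auto intro!: Ck_on_add[OF \<open>open U\<close>] Suc.IH\<close>)
qed

lemma Ck_on_linear_comp:
  assumes "open U" "bounded_linear L" "Ck_on k U f"
  shows "Ck_on k U (\<lambda>p. L (f p))"
  using assms(3)
proof (induction k arbitrary: f)
  case 0
  then show ?case
    using bounded_linear.continuous_on[OF assms(2)] by simp
next
  case (Suc k)
  show ?case
    by (rule Ck_on_has_derivativeI[OF \<open>open U\<close> bounded_linear.has_derivative[OF assms(2)
          Ck_on_Suc_has_derivative[OF Suc.prems]]])
      (use Suc in auto)
qed

text \<open>The derivative in a fixed direction \<open>v\<close> is the derivative of
  \<open>f\<close> in the fixed direction \<open>L v\<close>, again composed with \<open>L\<close>,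
  so the induction closes.\<close>

lemma Ck_on_comp_linear:
  assumes "open V" "bounded_linear L" "L ` V \<subseteq> U" "Ck_on k U f"
  shows "Ck_on k V (\<lambda>p. f (L p))"
  using assms(4)
proof (induction k arbitrary: f)
  case 0
  then show ?case
    using continuous_on_compose2[OF _ linear_continuous_on[OF assms(2)] assms(3)] by simp
next
  case (Suc k)
  have "((\<lambda>p. f (L p)) has_derivative (\<lambda>v. frechet_derivative f (at (L p)) (L v))) (at p)"
    if "p \<in> V" for p
    using Ck_on_Suc_has_derivative[OF Suc.prems] that assms(3)
    by (intro has_derivative_compose[OF bounded_linear_imp_has_derivative[OF assms(2)]]) auto
  then show ?case
    by (rule Ck_on_has_derivativeI[OF \<open>open V\<close>]) (use Suc in auto)
qed

lemma Ck_on_inverse: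
  fixes f :: "'a::real_normed_vector \<Rightarrow> 'b::real_normed_div_algebra"
  assumes "open U" "\<And>p. p \<in> U \<Longrightarrow> f p \<noteq> 0" "Ck_on k U f"
  shows "Ck_on k U (\<lambda>p. inverse (f p))"
  using assms(3)
proof (induction k)
  case 0
  then show ?case using assms(2) by (simp add: continuous_on_inverse)
next
  case (Suc k)
  \<comment> \<open>The derivative of the inverse contains the inverse itself, whose regularity one
    order lower is the induction hypothesis for the same \<open>f\<close>.\<close>
  have *: "Ck_on k U (\<lambda>p. inverse (f p))"
    using Suc Ck_on_SucD by blast
  have "Ck_on k U (\<lambda>p. - (inverse (f p) * frechet_derivative f (at p) v * inverse (f p)))" for v
    by (intro Ck_on_linear_comp[where L = uminus] Ck_on_mult * \<open>open U\<close>
        bounded_linear_minus bounded_linear_ident) (use Suc.prems in simp)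
  then show ?case
    using assms(2) Ck_on_Suc_has_derivative[OF Suc.prems]
    by (intro Ck_on_has_derivativeI[OF \<open>open U\<close>]) (auto intro!: Deriv.has_derivative_inverse simp del: Ck_on.simps)
qed

lemma smooth_on_continuous_on: "smooth_on U f \<Longrightarrow> continuous_on U f"
  unfolding smooth_on_def using Ck_on.simps(1) by metis

lemma local_diffeo_onI:
  assumes "open U" "open W" "f ` U \<subseteq> W" "h ` W \<subseteq> U"
    and "\<And>p. p \<in> U \<Longrightarrow> h (f p) = p" "\<And>q. q \<in> W \<Longrightarrow> f (h q) = q"
    and "smooth_on U f" "smooth_on W h"
  shows "local_diffeo_on U f"
proof -
  have "homeomorphism U W f h"
    using assms by (intro homeomorphismI) (auto intro: smooth_on_continuous_on)
  then show ?thesis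
    unfolding local_diffeo_on_def using assms by blast
qed

section \<open>Contact maps\<close>

lemma theta_eq_Im: "theta p v = snd v + 2 * Im (cnj (fst p) * fst v)"
  by (simp add: theta_def algebra_simps)

lemma contact_factor_eq:
  assumes "\<And>v. pullback f theta p v = l * theta p v"
  shows "contact_factor f p = l"
  unfolding contact_factor_def
proof (rule the_equality)
  fix l' assume "\<forall>v. pullback f theta p v = l' * theta p v"
  from this[rule_format, of "(0, 1)"] assms[of "(0, 1)"] show "l' = l"
    by (simp add: theta_def)
qed (use assms in blast)

lemma pos_contact_onI:
  assumes "local_diffeo_on U f" "\<And>p. p \<in> U \<Longrightarrow> l p > 0"
    and l: "\<And>p v. p \<in> U \<Longrightarrow> pullback f theta p v = l p * theta p v"
  shows "pos_contact_on U f"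
proof -
  have "contact_factor f p = l p" if "p \<in> U" for p
    by (rule contact_factor_eq) (rule l[OF that])
  then show ?thesis
    unfolding pos_contact_on_def contact_on_def
    using assms by (auto intro!: exI[of _ l] simp: less_imp_neq[symmetric])
qed

lemma pullback_comp:
  assumes "f differentiable at (g p)" "g differentiable at p"
  shows "pullback (f \<circ> g) \<omega> p v = pullback f \<omega> (g p) (frechet_derivative g (at p) v)"
  using frechet_derivative_compose[OF assms(2,1)] by (simp add: pullback_def)

section \<open>Linear actions and the inversion\<close>

text \<open>The coefficients of \<open>z\<close> and \<open>cnj z\<close> are the \<open>m\<close>
  and \<open>n\<close> of the overview; in this form the action of \<open>Z\<close> can be read
  off.\<close>

lemma linear_action_eq:
  "linear_action a b c d p =
    (Complex ((a + d) / 2) ((c - b) / 2) * fst p + Complex ((a - d) / 2) ((c + b) / 2) * cnj (fst p), snd p)"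
  by (simp add: linear_action_def Let_def complex_eq_iff)
    (simp add: add_divide_distrib diff_divide_distrib distrib_right left_diff_distrib)

lemma bounded_linear_linear_action: "bounded_linear (linear_action a b c d)"
  unfolding linear_action_eq[abs_def]
  by (intro bounded_linear_Pair bounded_linear_add bounded_linear_const_mult bounded_linear_fst
      bounded_linear_snd bounded_linear_compose[OF bounded_linear_cnj])

text \<open>For determinant 1 the adjugate matrix is the inverse.\<close>

lemma linear_action_inverse:
  assumes "a * d - b * c = 1"
  shows "linear_action a b c d (linear_action d (- b) (- c) a p) = p"
proof -
  have "a * (d * x - b * y) + b * (a * y - c * x) = x * (a * d - b * c)"
    "c * (d * x - b * y) + d * (a * y - c * x) = y * (a * d - b * c)" for x y
    by (simp_all add: algebra_simps)
  then show ?thesis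
    using assms by (simp add: linear_action_def Let_def prod_eq_iff)
qed

lemma linear_action_eq_0_iff:
  assumes "a * d - b * c = 1"
  shows "linear_action a b c d p = 0 \<longleftrightarrow> p = 0"
proof -
  have "linear_action d (- b) (- c) a (linear_action a b c d p) = p"
    using linear_action_inverse[of d a "- b" "- c" p] assms by (simp add: mult.commute)
  then show ?thesis
    using linear_simps(3)[OF bounded_linear_linear_action] by metis
qed

text \<open>Apart from \<open>dt\<close>, theta is twice the area form applied to the base point and
  the tangent vector, and the matrix scales area by its determinant.\<close>

lemma theta_linear_action:
  assumes "a * d - b * c = 1"
  shows "theta (linear_action a b c d p) (linear_action a b c d v) = theta p v"
proof -
  have "theta (linear_action a b c d p) (linear_action a b c d v) =
    snd v + 2 * (a * d - b * c) * (Re (fst p) * Im (fst v) - Im (fst p) * Re (fst v))"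
    unfolding theta_def linear_action_def Let_def fst_conv snd_conv complex.sel by algebra
  then show ?thesis using assms by (simp add: theta_def)
qed

lemma frechet_derivative_linear_action:
  "frechet_derivative (linear_action a b c d) (at p) = linear_action a b c d"
  by (metis bounded_linear_imp_has_derivative bounded_linear_linear_action frechet_derivative_at)

lemma pullback_linear_action:
  assumes "a * d - b * c = 1"
  shows "pullback (linear_action a b c d) theta p v = theta p v"
  by (simp add: pullback_def frechet_derivative_linear_action theta_linear_action assms)

text \<open>The denominator of the inversion; its modulus is the square of \<open>heis_norm\<close>.
  The product \<open>fst p * cnj (fst p)\<close> keeps it polynomial in the coordinates.\<close>

definition koranyi :: "heis \<Rightarrow> complex" where
  "koranyi p = \<i> * of_real (snd p) - fst p * cnj (fst p)"

lemma koranyi_eq_Complex: "koranyi p = Complex (- (cmod (fst p))\<^sup>2) (snd p)"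
  by (simp add: koranyi_def complex_eq_iff cmod_power2) (simp add: power2_eq_square)

lemma koranyi_eq_0_iff: "koranyi p = 0 \<longleftrightarrow> p = 0"
  by (auto simp: koranyi_eq_Complex complex_eq_iff prod_eq_iff)

lemma cmod_koranyi: "(cmod (koranyi p))\<^sup>2 = cmod (fst p) ^ 4 + (snd p)\<^sup>2"
  by (simp add: koranyi_eq_Complex cmod_power2[of "Complex _ _"])

lemma inversion_eq: "inversion p = (fst p * inverse (koranyi p), Im (inverse (koranyi p)))"
proof -
  have "\<i> * of_real (snd p) - of_real ((cmod (fst p))\<^sup>2) = koranyi p"
    by (simp add: koranyi_eq_Complex complex_eq_iff)
  then show ?thesis
    by (simp add: inversion_def Let_def divide_inverse) (simp add: koranyi_eq_Complex divide_inverse)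
qed

text \<open>With \<open>w\<close> the inverse of \<open>koranyi p\<close>, the new squared modulus
  is |z|^2 |w|^2 = - Re w, because |z|^2 = - Re (koranyi p). At the origin both sides are 0.\<close>

lemma koranyi_inversion: "koranyi (inversion p) = inverse (koranyi p)"
proof -
  have "(cmod (fst p * inverse (koranyi p)))\<^sup>2 = - Re (inverse (koranyi p))"
    by (simp add: norm_mult norm_inverse power_mult_distrib power_inverse cmod_koranyi)
      (simp add: koranyi_eq_Complex divide_inverse)
  then show ?thesis
    unfolding inversion_eq koranyi_eq_Complex[of "(_, _)"] fst_conv snd_conv
    by (intro complex_eqI) (simp_all del: inverse_complex.sel)
qed

text \<open>By \<open>koranyi_inversion\<close> the second application multiplies z w by 1/w and has
  Im (1/w) = t as its last component.\<close>

lemma inversion_inversion: "inversion (inversion p) = p"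
proof (cases "p = 0")
  case True
  then show ?thesis by (simp add: inversion_def prod_eq_iff)
next
  case False
  then show ?thesis
    unfolding inversion_eq[of "inversion p"] koranyi_inversion
    by (simp add: inversion_eq koranyi_eq_0_iff prod_eq_iff[of _ p] mult.assoc)
      (simp add: koranyi_eq_Complex)
qed

lemma inversion_eq_0_iff: "inversion p = 0 \<longleftrightarrow> p = 0"
  by (metis koranyi_eq_0_iff koranyi_inversion inverse_nonzero_iff_nonzero)

section \<open>Smoothness and contact factor of the inversion\<close>

lemma open_minus_origin: "open (- {0 :: heis})"
  by (rule open_Compl) (rule closed_singleton)

lemma smooth_on_inversion: "smooth_on (- {0}) inversion"
  unfolding smooth_on_def
proof
  fix k
  note U = open_minus_origin
  have lin: "Ck_on k (- {0}) L" if "bounded_linear L" for L :: "heis \<Rightarrow> complex"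
    using Ck_on_linear[OF U that] .
  have "Ck_on k (- {0}) (\<lambda>p. \<i> * of_real (snd p) + - (fst p * cnj (fst p)))"
    by (intro Ck_on_add Ck_on_linear_comp[where L = uminus] Ck_on_mult lin U bounded_linear_minus
        bounded_linear_ident bounded_linear_fst bounded_linear_compose[OF bounded_linear_cnj]
        bounded_linear_const_mult bounded_linear_compose[OF bounded_linear_of_real] bounded_linear_snd)
  then have "Ck_on k (- {0}) koranyi"
    by (simp add: koranyi_def[abs_def])
  then have w: "Ck_on k (- {0}) (\<lambda>p. inverse (koranyi p))"
    by (intro Ck_on_inverse U) (auto simp: koranyi_eq_0_iff)
  \<comment> \<open>The pair (z w, Im w) is assembled as a sum of two linear images, to which the
    closure rules for sums and linear maps apply.\<close>
  have L: "bounded_linear (\<lambda>z::complex. (z, 0::real))" "bounded_linear (\<lambda>z. (0::complex, Im z))"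
    by (intro bounded_linear_Pair bounded_linear_ident bounded_linear_zero bounded_linear_Im)+
  have "Ck_on k (- {0}) (\<lambda>p. (fst p * inverse (koranyi p), 0) + (0, Im (inverse (koranyi p))))"
    using Ck_on_add[OF U Ck_on_linear_comp[OF U L(1) Ck_on_mult[OF U lin[OF bounded_linear_fst] w]]
        Ck_on_linear_comp[OF U L(2) w]] .
  then show "Ck_on k (- {0}) inversion"
    by (simp add: inversion_eq[abs_def])
qed

lemma differentiable_inversion: "p \<noteq> 0 \<Longrightarrow> inversion differentiable at p"
  using smooth_on_inversion unfolding smooth_on_def by (auto dest!: spec[of _ "Suc 0"])

lemma pullback_inversion:
  assumes "p \<noteq> 0"
  shows "pullback inversion theta p v = inverse ((cmod (koranyi p))\<^sup>2) * theta p v"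
proof -
  define w where "w = inverse (koranyi p)"
  define z where "z = fst p"
  define du where "du v = \<i> * of_real (snd v) - (z * cnj (fst v) + fst v * cnj z)" for v :: heis
  have du: "(koranyi has_derivative du) (at p)"
    unfolding koranyi_def[abs_def] du_def z_def
    by (auto intro!: derivative_eq_intros)
  have dw: "((\<lambda>p. inverse (koranyi p)) has_derivative (\<lambda>v. - (w * du v * w))) (at p)"
    unfolding w_def by (rule Deriv.has_derivative_inverse[OF _ du]) (simp add: assms koranyi_eq_0_iff)
  have "(inversion has_derivative (\<lambda>v. (z * - (w * du v * w) + fst v * w, Im (- (w * du v * w))))) (at p)"
    unfolding inversion_eq[abs_def] w_def z_def
    by (intro has_derivative_Pair has_derivative_mult has_derivative_fst has_derivative_ident
        bounded_linear.has_derivative[OF bounded_linear_Im] dw[unfolded w_def])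
  then have D: "frechet_derivative inversion (at p) =
      (\<lambda>v. (z * - (w * du v * w) + fst v * w, Im (- (w * du v * w))))"
    by (rule frechet_derivative_at[symmetric])
  define s where "s = (cmod w)\<^sup>2"
  have s: "s = Re w * Re w + Im w * Im w"
    unfolding s_def cmod_power2 by (simp add: power2_eq_square)
  \<comment> \<open>This relation, again |z|^2 = - Re (koranyi p), is what makes the inversion
    contact: it removes |z|^2 from the pulled-back form.\<close>
  have r: "(Re z * Re z + Im z * Im z) * s = - Re w"
  proof -
    have "Re z * Re z + Im z * Im z = (cmod z)\<^sup>2"
      unfolding cmod_power2 by (simp add: power2_eq_square)
    then show ?thesis
      by (simp add: s_def w_def norm_inverse power_inverse cmod_koranyi)
        (simp add: koranyi_eq_Complex z_def divide_inverse)
  qed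
  define e where "e = du v"
  \<comment> \<open>The rest of \<open>du v\<close> is z cnj(dz) plus its conjugate, hence
    real.\<close>
  have e: "Im e = snd v"
    by (simp add: e_def du_def)
  have "theta (inversion p) (frechet_derivative inversion (at p) v) =
      - Im (w * w * e) + 2 * s * Im (cnj z * fst v) - 2 * ((Re z * Re z + Im z * Im z) * s) * Im (w * e)"
    unfolding D theta_eq_Im inversion_eq e_def[symmetric] w_def[symmetric] z_def[symmetric] s fst_conv snd_conv
    by (simp only: times_complex.sel plus_complex.sel uminus_complex.sel complex_cnj_mult cnj.sel) algebra
  \<comment> \<open>With \<open>r\<close>, the two terms in \<open>e\<close> combine: - Im (w w e) +
    2 Re w Im (w e) = Im (cnj w w e) = |w|^2 Im e.\<close>
  also have "\<dots> = s * (Im e + 2 * Im (cnj z * fst v))"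
    unfolding r unfolding s
    by (simp only: times_complex.sel plus_complex.sel uminus_complex.sel complex_cnj_mult cnj.sel) algebra
  finally show ?thesis
    by (simp add: pullback_def theta_eq_Im e z_def s_def w_def norm_inverse power_inverse)
qed

text \<open>Contact factors multiply under composition: that of the inversion is taken at the image
  point, and the linear action contributes 1.\<close>

lemma pullback_inversion_linear_action:
  assumes "a * d - b * c = 1" "p \<noteq> 0"
  shows "pullback (inversion \<circ> linear_action a b c d) theta p v =
    inverse ((cmod (koranyi (linear_action a b c d p)))\<^sup>2) * theta p v"
proof -
  have "linear_action a b c d p \<noteq> 0"
    using linear_action_eq_0_iff assms by simp
  moreover have "linear_action a b c d differentiable at p"
    using bounded_linear_imp_differentiable bounded_linear_linear_action by blast
  ultimately show ?thesis
    by (simp add: pullback_comp differentiable_inversion pullback_inversion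
        frechet_derivative_linear_action theta_linear_action assms(1))
qed

section \<open>Positively oriented contact maps\<close>

lemma smooth_on_linear_action: "smooth_on UNIV (linear_action a b c d)"
  unfolding smooth_on_def by (simp add: Ck_on_linear bounded_linear_linear_action del: Ck_on.simps)

lemma pos_contact_on_inversion: "pos_contact_on (- {0}) inversion"
proof (rule pos_contact_onI)
  show "local_diffeo_on (- {0}) inversion"
    by (rule local_diffeo_onI[OF open_minus_origin open_minus_origin, of _ inversion])
      (auto simp: inversion_inversion smooth_on_inversion inversion_eq_0_iff)
qed (use pullback_inversion in \<open>auto simp: koranyi_eq_0_iff\<close>)

lemma pos_contact_on_linear_action:
  assumes "a * d - b * c = 1"
  shows "pos_contact_on UNIV (linear_action a b c d)"
proof (rule pos_contact_onI[where l = "\<lambda>p. 1"])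
  show "local_diffeo_on UNIV (linear_action a b c d)"
    by (rule local_diffeo_onI[of _ UNIV _ "linear_action d (- b) (- c) a"])
      (use assms linear_action_inverse[of a d b c] linear_action_inverse[of d a "- b" "- c"]
        in \<open>auto simp: smooth_on_linear_action mult.commute\<close>)
qed (auto simp: pullback_linear_action assms)

lemma pos_contact_on_inversion_linear_action:
  assumes "a * d - b * c = 1"
  shows "pos_contact_on (- {0}) (inversion \<circ> linear_action a b c d)"
proof (rule pos_contact_onI[where l = "\<lambda>p. inverse ((cmod (koranyi (linear_action a b c d p)))\<^sup>2)"])
  let ?g = "linear_action a b c d" and ?h = "linear_action d (- b) (- c) a"
  have det': "d * a - (- b) * (- c) = 1"
    using assms by (simp add: mult.commute)
  have gh: "?g (?h p) = p" and hg: "?h (?g p) = p" for p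
    using linear_action_inverse[OF assms] linear_action_inverse[OF det'] by simp_all
  have C: "Ck_on k (- {0}) inversion" for k
    using smooth_on_inversion unfolding smooth_on_def by blast
  have sub: "?g ` (- {0}) \<subseteq> - {0}"
    by (rule image_subsetI) (simp add: linear_action_eq_0_iff[OF assms])
  \<comment> \<open>The linear factor stands inside in the composition and outside in its inverse,
    hence the two different composition rules.\<close>
  have "smooth_on (- {0}) (inversion \<circ> ?g)" "smooth_on (- {0}) (?h \<circ> inversion)"
    unfolding smooth_on_def comp_def
    by (rule allI, rule Ck_on_comp_linear[OF open_minus_origin bounded_linear_linear_action sub C])
      (rule allI, rule Ck_on_linear_comp[OF open_minus_origin bounded_linear_linear_action C])
  then show "local_diffeo_on (- {0}) (inversion \<circ> ?g)"
    by (intro local_diffeo_onI[OF open_minus_origin open_minus_origin, of _ "?h \<circ> inversion"] image_subsetI)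
      (simp_all add: linear_action_eq_0_iff[OF assms] linear_action_eq_0_iff[OF det']
        inversion_inversion gh hg inversion_eq_0_iff)
qed (simp_all add: pullback_inversion_linear_action[OF assms] koranyi_eq_0_iff linear_action_eq_0_iff[OF assms])

section \<open>The Schwarzian derivative\<close>

text \<open>The coefficient of the t-derivative in \<open>Z\<close> is y + i x = i cnj z.\<close>

lemma Z_field_eq:
  assumes "(u has_derivative D) (at p)"
  shows "Z_field u p = (D (1, 0) - \<i> * D (\<i>, 0)) / 2 + \<i> * cnj (fst p) * D (0, 1)"
proof -
  have "frechet_derivative u (at p) = D"
    by (rule frechet_derivative_at[OF assms, symmetric])
  moreover have "\<i> * cnj (fst p) = of_real (Im (fst p)) + \<i> * of_real (Re (fst p))"
    by (simp add: complex_eq_iff)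
  ultimately show ?thesis
    by (simp add: Z_field_def X_field_def Y_field_def d_x_def d_y_def d_t_def field_simps)
qed

text \<open>Functions equal near \<open>p\<close> have the same candidate derivatives there, so the
  choice made by \<open>frechet_derivative\<close> is the same, even at points of
  non-differentiability.\<close>

lemma Z_field_cong:
  assumes "open U" "p \<in> U" "\<And>q. q \<in> U \<Longrightarrow> u q = v q"
  shows "Z_field u p = Z_field v p"
proof -
  have "(u has_derivative D) (at p) \<longleftrightarrow> (v has_derivative D) (at p)" for D
    using has_derivative_transform_within_open[OF _ assms(1,2), of u D UNIV v]
      has_derivative_transform_within_open[OF _ assms(1,2), of v D UNIV u] assms(3) by auto
  then show ?thesis
    by (simp add: Z_field_def X_field_def Y_field_def d_x_def d_y_def d_t_def frechet_derivative_def)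
qed

text \<open>Differentiability is bundled with the value so that the sum and Leibniz rules chain like
  those of \<open>has_derivative\<close>.\<close>

definition has_Z :: "(heis \<Rightarrow> complex) \<Rightarrow> complex \<Rightarrow> heis \<Rightarrow> bool" where
  "has_Z u l p \<longleftrightarrow> u differentiable at p \<and> Z_field u p = l"

lemma has_Z_I:
  assumes "(u has_derivative D) (at p)"
    and "l = (D (1, 0) - \<i> * D (\<i>, 0)) / 2 + \<i> * cnj (fst p) * D (0, 1)"
  shows "has_Z u l p"
  unfolding has_Z_def using assms Z_field_eq[OF assms(1)] by (auto simp: differentiable_def)

lemma has_Z_E:
  assumes "has_Z u l p"
  obtains D where "(u has_derivative D) (at p)"
    and "l = (D (1, 0) - \<i> * D (\<i>, 0)) / 2 + \<i> * cnj (fst p) * D (0, 1)"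
  using assms Z_field_eq unfolding has_Z_def differentiable_def by blast

section \<open>Rules for Z on polynomials in z, cnj z and t\<close>

lemma has_Z_const: "has_Z (\<lambda>q. c) 0 p"
  by (rule has_Z_I[OF has_derivative_const]) simp

lemma has_Z_z: "has_Z fst 1 p"
  by (rule has_Z_I[OF has_derivative_fst[OF has_derivative_ident]]) simp

lemma has_Z_cnj_z: "has_Z (\<lambda>q. cnj (fst q)) 0 p"
  by (rule has_Z_I[OF has_derivative_cnj[OF has_derivative_fst[OF has_derivative_ident]]]) simp

lemma has_Z_t: "has_Z (\<lambda>q. of_real (snd q)) (\<i> * cnj (fst p)) p"
  by (rule has_Z_I[OF has_derivative_of_real[OF has_derivative_snd[OF has_derivative_ident]]]) simp

lemma has_Z_add:
  assumes "has_Z u k p" "has_Z v l p"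
  shows "has_Z (\<lambda>q. u q + v q) (k + l) p"
  using assms
  by (auto elim!: has_Z_E intro!: has_Z_I[OF has_derivative_add] simp: field_simps)

lemma has_Z_mult:
  assumes "has_Z u k p" "has_Z v l p"
  shows "has_Z (\<lambda>q. u q * v q) (u p * l + k * v p) p"
  using assms
  by (auto elim!: has_Z_E intro!: has_Z_I[OF has_derivative_mult] simp: field_simps)

lemmas has_Z_intros = has_Z_const has_Z_z has_Z_cnj_z has_Z_t has_Z_add has_Z_mult

lemma Z_field_eqI: "has_Z u l p \<Longrightarrow> l = l' \<Longrightarrow> Z_field u p = l'"
  by (simp add: has_Z_def)

text \<open>\<open>H\<close> is the conjugate of \<open>G\<close>, spelled out as a polynomial
  because \<open>Z\<close> does not commute with conjugation. The difference of squares 2 (m H + cnj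
  n G)^2 - 2 (m H - cnj n G)^2 gives 8 G H m cnj n, which joins the remaining 4 G H m cnj n.\<close>

lemma Z_field_Z_field_gauge:
  fixes m n :: complex
  assumes "m * cnj m - n * cnj n = 1"
    and G_def: "G = (\<lambda>q :: heis. m * fst q + n * cnj (fst q))"
    and H_def: "H = (\<lambda>q :: heis. cnj n * fst q + cnj m * cnj (fst q))"
  shows "Z_field (Z_field (\<lambda>q. (G q * H q) * (G q * H q) + of_real (snd q) * of_real (snd q))) p =
    12 * (G p * H p) * m * cnj n"
proof -
  have G: "has_Z G m q" and H: "has_Z H (cnj n) q" for q
  proof -
    have "has_Z G (m * 1 + 0 * fst q + (n * 0 + 0 * cnj (fst q))) q"
      unfolding G_def by (intro has_Z_intros)
    then show "has_Z G m q" by simp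
    have "has_Z H (cnj n * 1 + 0 * fst q + (cnj m * 0 + 0 * cnj (fst q))) q"
      unfolding H_def by (intro has_Z_intros)
    then show "has_Z H (cnj n) q" by simp
  qed
  have "Z_field (\<lambda>q. (G q * H q) * (G q * H q) + of_real (snd q) * of_real (snd q)) =
      (\<lambda>q. 2 * ((G q * H q) * (G q * cnj n + m * H q)) + 2 * \<i> * (of_real (snd q) * cnj (fst q)))"
    by (rule ext, rule Z_field_eqI, (rule has_Z_intros G H)+) (simp add: algebra_simps)
  moreover have "Z_field (\<lambda>q. 2 * ((G q * H q) * (G q * cnj n + m * H q)) +
        2 * \<i> * (of_real (snd q) * cnj (fst q))) p =
      2 * (G p * cnj n + m * H p)\<^sup>2 + 4 * (G p * H p) * m * cnj n - 2 * (cnj (fst p))\<^sup>2"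
    by (rule Z_field_eqI, (rule has_Z_intros G H)+) (simp add: algebra_simps power2_eq_square)
  moreover have "cnj (fst p) = m * H p - cnj n * G p"
  proof -
    have "m * H p - cnj n * G p = (m * cnj m - n * cnj n) * cnj (fst p)"
      by (simp add: G_def H_def algebra_simps)
    then show ?thesis using assms(1) by simp
  qed
  ultimately show ?thesis
    by (simp add: algebra_simps power2_eq_square)
qed

lemma Z_field_linear_action:
  "Z_field (\<lambda>q. fst (linear_action a b c d q)) p = Complex ((a + d) / 2) ((c - b) / 2)"
  "Z_field (\<lambda>q. cnj (fst (linear_action a b c d q))) p = cnj (Complex ((a - d) / 2) ((c + b) / 2))"
proof -
  show "Z_field (\<lambda>q. fst (linear_action a b c d q)) p = Complex ((a + d) / 2) ((c - b) / 2)"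
    unfolding linear_action_eq fst_conv
    by (rule Z_field_eqI, (rule has_Z_intros)+) simp
  show "Z_field (\<lambda>q. cnj (fst (linear_action a b c d q))) p = cnj (Complex ((a - d) / 2) ((c + b) / 2))"
    unfolding linear_action_eq fst_conv complex_cnj_add complex_cnj_mult complex_cnj_cnj
    by (rule Z_field_eqI, (rule has_Z_intros)+) simp
qed

lemma S_CR_inversion_linear_action:
  assumes "a * d - b * c = 1" "p \<noteq> 0"
  shows "S_CR (inversion \<circ> linear_action a b c d) p =
    6 * (of_real ((cmod (fst (linear_action a b c d p)))\<^sup>2) /
      of_real (cmod (fst (linear_action a b c d p)) ^ 4 + (snd p)\<^sup>2)) *
    Complex ((a + d) / 2) ((c - b) / 2) * cnj (Complex ((a - d) / 2) ((c + b) / 2))"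
proof -
  let ?f = "inversion \<circ> linear_action a b c d"
  define m n where "m = Complex ((a + d) / 2) ((c - b) / 2)" and "n = Complex ((a - d) / 2) ((c + b) / 2)"
  define G where "G = (\<lambda>q :: heis. m * fst q + n * cnj (fst q))"
  define H where "H = (\<lambda>q :: heis. cnj n * fst q + cnj m * cnj (fst q))"
  have G: "fst (linear_action a b c d q) = G q" for q
    by (simp add: linear_action_eq G_def m_def n_def)
  have GH: "G q * H q = of_real ((cmod (G q))\<^sup>2)" for q
    by (simp add: complex_norm_square G_def H_def algebra_simps del: of_real_power)
  have mn: "m * cnj m - n * cnj n = 1"
  proof -
    have "m * cnj m - n * cnj n = of_real (a * d - b * c)"
      by (simp add: m_def n_def complex_eq_iff field_simps)
    then show ?thesis using assms(1) by simp
  qed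
  have cf: "contact_factor ?f q = inverse (cmod (G q) ^ 4 + (snd q)\<^sup>2)" if "q \<noteq> 0" for q
    using contact_factor_eq[OF pullback_inversion_linear_action[OF assms(1) that]] cmod_koranyi[of "linear_action a b c d q"]
    by (simp add: G) (simp add: linear_action_eq)
  define N where "N = (\<lambda>q. (G q * H q) * (G q * H q) + complex_of_real (snd q) * of_real (snd q))"
  have N: "N q = of_real (cmod (G q) ^ 4 + (snd q)\<^sup>2)" for q
    by (simp add: N_def GH power4_eq_xxxx power2_eq_square mult.assoc)
  have inv: "of_real (inverse (contact_factor ?f q)) = N q" if "q \<in> - {0}" for q
    using that by (simp add: cf N)
  \<comment> \<open>The contact factor is known only off the origin, an open set; locality of
    \<open>Z\<close>, used for both applications, replaces its inverse by the polynomial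
    \<open>N\<close>.\<close>
  have "Z_field (Z_field (\<lambda>q. of_real (inverse (contact_factor ?f q)))) p = Z_field (Z_field N) p"
    by (intro Z_field_cong[OF open_minus_origin] inv) (use assms in auto)
  also have "\<dots> = 12 * (G p * H p) * m * cnj n"
    unfolding N_def by (rule Z_field_Z_field_gauge[OF mn G_def H_def])
  finally have ZZ: "Z_field (Z_field (\<lambda>q. of_real (inverse (contact_factor ?f q)))) p =
    12 * (G p * H p) * m * cnj n" .
  \<comment> \<open>The 6 is the factor 1/2 of \<open>S_CR\<close> times 12, and the contact factor
    is 1/N.\<close>
  have "S_CR ?f p = 6 * (of_real ((cmod (G p))\<^sup>2) / of_real (cmod (G p) ^ 4 + (snd p)\<^sup>2)) * m * cnj n"
    unfolding S_CR_def ZZ unfolding cf[OF assms(2)] GH of_real_inverse divide_inverse by simp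
  then show ?thesis
    by (simp only: G m_def n_def)
qed

lemma heis_norm_power4: "heis_norm p ^ 4 = cmod (fst p) ^ 4 + (snd p)\<^sup>2"
  by (simp add: heis_norm_def)

theorem claim3:
  fixes a b c d :: real and f g :: "heis \<Rightarrow> heis" and G :: "heis \<Rightarrow> complex"
  assumes det: "a * d - b * c = 1"
    and f: "f = inversion"
    and g: "g = linear_action a b c d"
    and G: "G = (\<lambda>p. fst (g p))"
  shows "pos_contact_on (- {0}) f \<and> pos_contact_on UNIV g \<and> pos_contact_on (- {0}) (f \<circ> g) \<and>
    (\<forall>p. p \<noteq> 0 \<longrightarrow> S_CR (f \<circ> g) p =
       6 * (of_real ((cmod (G p))\<^sup>2) / of_real (heis_norm (g p) ^ 4)) *
         Z_field G p * Z_field (\<lambda>q. cnj (G q)) p) \<and>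
    (\<forall>p. p \<noteq> 0 \<longrightarrow> S_CR f p = 0) \<and>
    (\<forall>p. S_CR g p = 0) \<and>
    (\<not> (a = d \<and> b = - c) \<longrightarrow> (\<exists>p. p \<noteq> 0 \<and> S_CR (f \<circ> g) p \<noteq> 0))"
proof (intro conjI allI impI)
  show "pos_contact_on (- {0}) f" "pos_contact_on UNIV g" "pos_contact_on (- {0}) (f \<circ> g)"
    unfolding f g by (intro pos_contact_on_inversion pos_contact_on_linear_action
        pos_contact_on_inversion_linear_action det)+
next
  fix p :: heis assume "p \<noteq> 0"
  have "snd (g p) = snd p"
    by (simp add: g linear_action_eq)
  then show "S_CR (f \<circ> g) p = 6 * (of_real ((cmod (G p))\<^sup>2) / of_real (heis_norm (g p) ^ 4)) *
      Z_field G p * Z_field (\<lambda>q. cnj (G q)) p"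
    unfolding heis_norm_power4 G
    using S_CR_inversion_linear_action[OF det \<open>p \<noteq> 0\<close>] Z_field_linear_action[of a b c d p]
    by (simp add: f g)
  \<comment> \<open>The inversion alone is the case of the identity matrix, where n = 0.\<close>
  have "linear_action 1 0 0 1 = id"
    by (simp add: linear_action_def fun_eq_iff Let_def)
  then show "S_CR f p = 0"
    using S_CR_inversion_linear_action[of 1 1 0 0 p] \<open>p \<noteq> 0\<close> by (simp add: f Complex_eq)
next
  fix p
  have "contact_factor g = (\<lambda>q. 1)"
    unfolding g by (intro ext contact_factor_eq) (simp add: pullback_linear_action det)
  moreover have "Z_field (\<lambda>q. c) = (\<lambda>q. 0)" for c
    using has_Z_const by (auto simp: has_Z_def)
  ultimately show "S_CR g p = 0"
    by (simp add: S_CR_def)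
next
  \<comment> \<open>The excluded matrices are exactly those with n = 0, the rotations.\<close>
  assume "\<not> (a = d \<and> b = - c)"
  then have n: "cnj (Complex ((a - d) / 2) ((c + b) / 2)) \<noteq> 0"
    by (auto simp: complex_eq_iff)
  \<comment> \<open>If m were 0, the determinant would be - |n|^2, which is not 1.\<close>
  have m: "Complex ((a + d) / 2) ((c - b) / 2) \<noteq> 0"
  proof
    assume "Complex ((a + d) / 2) ((c - b) / 2) = 0"
    then have "d = - a" "c = b"
      by (auto simp: complex_eq_iff)
    then have "a * d - b * c = - (a * a + b * b)" by simp
    then show False using det by (smt (verit) zero_le_square)
  qed
  \<comment> \<open>At (1, 0) the value of \<open>G\<close> is a + i c, the first column of an
    invertible matrix.\<close>
  have "fst (linear_action a b c d (1, 0)) \<noteq> 0"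
    using det by (auto simp: linear_action_def complex_eq_iff)
  then have "S_CR (f \<circ> g) (1, 0) \<noteq> 0"
    using S_CR_inversion_linear_action[OF det, of "(1, 0)"] m n by (simp add: f g prod_eq_iff)
  moreover have "(1, 0) \<noteq> (0 :: heis)"
    by (simp add: prod_eq_iff)
  ultimately show "\<exists>p. p \<noteq> 0 \<and> S_CR (f \<circ> g) p \<noteq> 0"
    by blast
qed

end
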